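(* Let $\rho\in\{3,4,5,\dots\}$ and let $q$ be a complex number with $0<|q|<1$; put $p=q^{-1}$. Then the following three series converge and are equal: \[ \sum_{n=0}^\infty (-1)^n q^{n[(\rho-2) n-(\rho-4)]/2} =1+\sum_{n=1}^\infty (-1)^n q^n\frac{(1+q)(1+q^{1+(2\rho-4)})\cdots(1+q^{1+(2\rho-4)(n-1)})}{(1+q^{\rho-1})(1+q^{\rho-1+(2\rho-4)})\cdots(1+q^{\rho-1+(2\rho-4)(n-1)})} \] \[ =1+\sum_{n=1}^\infty (-1)^n p^{(\rho-3)n} \frac{(1+p)(1+p^{1+(2\rho-4)})\cdots(1+p^{1+(2\rho-4)(n-1)})}{(1+p^{\rho-1})(1+p^{\rho-1+(2\rho-4)})\cdots(1+p^{\rho-1+(2\rho-4)(n-1)})}. \] Equivalently, in $q$-Pochhammer notation, \[ \sum_{n=0}^\infty (-1)^n q^{n[(\rho-2)n-(\rho-4)]/2}=\sum_{n=0}^\infty (-1)^n q^n\frac{(-q;q^{2\rho-4})_n}{(-q^{\rho-1};q^{2\rho-4})_n}=\sum_{n=0}^\infty (-1)^n p^{(\rho-3)n}\frac{(-p;p^{2\rho-4})_n}{(-p^{\rho-1};p^{2\rho-4})_n}. \]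
   Context: The $q$-Pochhammer symbol is defined by $(\alpha;q)_0=1$ and $(\alpha;q)_n=(\alpha;q)_{n-1}(1-\alpha q^{n-1})$ for $n\ge1$. In each product in the fractions, the exponents increase in steps of $2\rho-4$, and each product has exactly $n$ factors. *)

theory Defs
  imports Complex_Main
begin

primrec qpoch :: "complex \<Rightarrow> complex \<Rightarrow> nat \<Rightarrow> complex" where
  "qpoch \<alpha> q 0 = 1"
| "qpoch \<alpha> q (Suc n) = qpoch \<alpha> q n * (1 - \<alpha> * q ^ n)"

text \<open>
  The exponent \<open>n ((\<rho> - 2) n - (\<rho> - 4)) / 2\<close>. The factor \<open>\<rho> - 4\<close> is negative for \<open>\<rho> = 3\<close>,
  so the expression is formed over the integers; the product is always even, so the
  division by 2 is exact.
\<close>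
definition theta_exp :: "nat \<Rightarrow> nat \<Rightarrow> int" where
  "theta_exp \<rho> n = (int n * ((int \<rho> - 2) * int n - (int \<rho> - 4))) div 2"

end

theory Submission
  imports Defs
begin

text \<open>
  With \<open>r = q\<^bsup>\<rho>-2\<^esup>\<close> put
  \<open>S(x) = \<Sum>k. (-x)^k (-x; r\<^sup>2)\<^sub>k / (-xr; r\<^sup>2)\<^sub>k\<close>. A telescoping argument
  gives \<open>S(x) = 1 - x + x\<^sup>2 r S(x r\<^sup>2)\<close>; iterating it from \<open>x = q\<close> produces the partial theta
  series two terms at a time, and the remainder vanishes because \<open>S\<close> is bounded on
  \<open>\<bar>x\<bar> \<le> \<bar>q\<bar>\<close>. Pulling the leading powers of \<open>p\<close> out of each factor shows that the third
  series agrees with the second term by term.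
\<close>

section \<open>Convergence and uniform bounds for \<open>S(x)\<close>\<close>

definition fine_term :: "complex \<Rightarrow> complex \<Rightarrow> nat \<Rightarrow> complex" where
  "fine_term x r k = (- x) ^ k * (qpoch (- x) (r\<^sup>2) k / qpoch (- (x * r)) (r\<^sup>2) k)"

text \<open>With \<open>s = norm r\<close>, the factor at \<open>j\<close> bounds the modulus of the
  ratio of the terms \<open>j + 1\<close> and \<open>j\<close> of \<open>S(x)\<close> for every x
  with \<open>norm x \<le> a\<close>.\<close>

definition fine_majorant :: "real \<Rightarrow> real \<Rightarrow> nat \<Rightarrow> real" where
  "fine_majorant a s k = (\<Prod>j<k. a * ((1 + a * s ^ j) / (1 - a * s ^ j)))"

lemma qpoch_uminus_prod: "qpoch (- a) b n = (\<Prod>k<n. 1 + a * b ^ k)"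
  by (induction n) auto

lemma one_plus_nonzero:
  fixes z :: complex
  assumes "norm z \<noteq> 1"
  shows "1 + z \<noteq> 0"
proof
  assume "1 + z = 0"
  then have "z = - 1" by (simp add: eq_neg_iff_add_eq_0 add.commute)
  with assms show False by simp
qed

lemma norm_mult_power_less_one:
  fixes x r :: complex
  assumes "norm x < 1" "norm r < 1"
  shows "norm (x * r ^ k) < 1"
proof -
  have "norm (x * r ^ k) \<le> norm x"
    using assms by (simp add: norm_mult norm_power mult_left_le power_le_one)
  with assms show ?thesis by simp
qed

lemma fine_term_Suc:
  "fine_term x r (Suc k) =
    fine_term x r k * (- x * (1 + x * r ^ (2 * k)) / (1 + x * r * r ^ (2 * k)))"
  by (simp add: fine_term_def power_mult)

lemma fine_majorant_nonneg:
  assumes "0 \<le> a" "a < 1" "0 \<le> s" "s < 1"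
  shows "0 \<le> fine_majorant a s k"
  unfolding fine_majorant_def
proof (rule prod_nonneg)
  fix j
  have "a * s ^ j \<le> 1" "0 \<le> a * s ^ j"
    using assms by (simp_all add: mult_le_one power_le_one)
  then show "0 \<le> a * ((1 + a * s ^ j) / (1 - a * s ^ j))"
    using assms by simp
qed

text \<open>The ratio of consecutive values tends to a < 1, so any c strictly between a and 1
  eventually bounds it and the ratio test applies.\<close>

lemma summable_fine_majorant:
  assumes "0 \<le> a" "a < 1" "0 \<le> s" "s < 1"
  shows "summable (fine_majorant a s)"
proof -
  obtain c where c: "a < c" "c < 1"
    using dense assms by blast
  have "(\<lambda>j. a * ((1 + a * s ^ j) / (1 - a * s ^ j))) \<longlonglongrightarrow>
      a * ((1 + a * 0) / (1 - a * 0))"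
    using assms by (intro tendsto_intros) auto
  then have "\<forall>\<^sub>F j in sequentially. a * ((1 + a * s ^ j) / (1 - a * s ^ j)) < c"
    using c by (intro order_tendstoD) auto
  then obtain N where N: "\<And>j. j \<ge> N \<Longrightarrow> a * ((1 + a * s ^ j) / (1 - a * s ^ j)) < c"
    by (auto simp: eventually_sequentially)
  show ?thesis
  proof (rule summable_ratio_test)
    fix n assume n: "N \<le> n"
    have "fine_majorant a s (Suc n) =
        fine_majorant a s n * (a * ((1 + a * s ^ n) / (1 - a * s ^ n)))"
      by (simp add: fine_majorant_def)
    also have "\<dots> \<le> fine_majorant a s n * c"
      using N[OF n] fine_majorant_nonneg[OF assms] by (intro mult_left_mono) auto
    finally show "norm (fine_majorant a s (Suc n)) \<le> c * norm (fine_majorant a s n)"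
      using fine_majorant_nonneg[OF assms] by (simp add: mult.commute)
  qed (use c in auto)
qed

lemma norm_fine_term_le:
  assumes "norm x \<le> a" "a < 1" "norm r < 1"
  shows "norm (fine_term x r k) \<le> fine_majorant a (norm r) k"
proof (induction k)
  case 0
  show ?case by (simp add: fine_term_def fine_majorant_def)
next
  case (Suc k)
  define s where "s = norm r"
  have a0: "0 \<le> a" using assms norm_ge_zero order_trans by blast
  have s: "0 \<le> s" "s < 1" using assms by (auto simp: s_def)
  have pos: "a * s ^ k < 1"
    using assms a0 s by (metis le_less_trans mult_left_le power_le_one less_imp_le)
  \<comment> \<open>The exponents \<open>2 * k\<close> in the numerator and \<open>2 * k + 1\<close>
    in the denominator are both at least k, so the single bound \<open>a * s ^ k\<close> serves
    both.\<close>
  have le: "norm (x * r ^ j) \<le> a * s ^ k" if "k \<le> j" for j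
    using assms a0 s that
    by (auto simp: norm_mult norm_power s_def intro!: mult_mono power_decreasing)
  have num: "norm (1 + x * r ^ (2 * k)) \<le> 1 + a * s ^ k"
    using norm_triangle_ineq[of 1 "x * r ^ (2 * k)"] le[of "2 * k"] by simp
  have den: "1 - a * s ^ k \<le> norm (1 + x * r * r ^ (2 * k))"
    using norm_diff_ineq[of 1 "x * r * r ^ (2 * k)"] le[of "Suc (2 * k)"]
    by (simp add: mult.assoc)
  have "norm (- x * (1 + x * r ^ (2 * k)) / (1 + x * r * r ^ (2 * k))) =
      norm x * (norm (1 + x * r ^ (2 * k)) / norm (1 + x * r * r ^ (2 * k)))"
    by (simp add: norm_mult norm_divide)
  also have "\<dots> \<le> a * ((1 + a * s ^ k) / (1 - a * s ^ k))"
    using assms a0 s pos num den by (intro mult_mono frac_le) auto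
  finally have "norm (fine_term x r (Suc k)) \<le>
      fine_majorant a s k * (a * ((1 + a * s ^ k) / (1 - a * s ^ k)))"
    unfolding fine_term_Suc norm_mult[of "fine_term x r k"]
    using Suc.IH a0 s assms fine_majorant_nonneg
    by (intro mult_mono) (auto simp: s_def)
  then show ?case by (simp add: fine_majorant_def s_def)
qed

lemma summable_norm_fine_term:
  assumes "norm x < 1" "norm r < 1"
  shows "summable (\<lambda>k. norm (fine_term x r k))"
  by (rule summable_comparison_test'[OF summable_fine_majorant[of "norm x" "norm r"]])
     (use assms in \<open>auto intro: norm_fine_term_le\<close>)

lemma summable_fine_term:
  assumes "norm x < 1" "norm r < 1"
  shows "summable (fine_term x r)"
  using summable_norm_fine_term[OF assms] by (rule summable_norm_cancel)

text \<open>The bound depends on x only through a, hence is uniform on a closed disc; this controls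
  the remainder when the functional equation is iterated.\<close>

lemma norm_suminf_fine_term_le:
  assumes "norm x \<le> a" "a < 1" "norm r < 1"
  shows "norm (suminf (fine_term x r)) \<le> suminf (fine_majorant a (norm r))"
proof -
  have "0 \<le> a" using assms norm_ge_zero order_trans by blast
  then have maj: "summable (fine_majorant a (norm r))"
    using assms by (intro summable_fine_majorant) auto
  have sum: "summable (\<lambda>k. norm (fine_term x r k))"
    using assms by (intro summable_norm_fine_term) auto
  show ?thesis
    using summable_norm[OF sum] suminf_le[OF norm_fine_term_le[OF assms] sum maj]
    by (rule order_trans)
qed

section \<open>The functional equation by telescoping\<close>

text \<open>Replacing x by \<open>x * r\<^sup>2\<close> shifts both Pochhammer symbols by one step,
  so each trades its first factor, \<open>1 + x\<close> or \<open>1 + x * r\<close>, for the next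
  one at the end; the power of \<open>- x\<close> supplies \<open>r ^ (2 * k)\<close>. This is the
  resulting quotient, cross-multiplied.\<close>

lemma fine_term_shift:
  assumes "norm x < 1" "norm r < 1"
  shows "(1 + x) * (1 + x * r * r ^ (2 * k)) * fine_term (x * r\<^sup>2) r k =
    fine_term x r k * r ^ (2 * k) * (1 + x * r ^ (2 * k)) * (1 + x * r)"
proof (induction k)
  case 0
  show ?case by (simp add: fine_term_def)
next
  case (Suc k)
  define u where "u = r ^ (2 * k)"
  define A where "A = fine_term x r k"
  define B where "B = fine_term (x * r\<^sup>2) r k"
  have u: "r ^ (2 * Suc k) = r\<^sup>2 * u" by (simp add: u_def power2_eq_square)
  have n1: "1 + x * r * u \<noteq> 0"
    using one_plus_nonzero[of "x * r ^ Suc (2 * k)"]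
      norm_mult_power_less_one[OF assms, of "Suc (2 * k)"] by (auto simp: u_def mult_ac)
  have n2: "1 + x * r * (r\<^sup>2 * u) \<noteq> 0"
    using one_plus_nonzero[of "x * r ^ (2 * k + 3)"]
      norm_mult_power_less_one[OF assms, of "2 * k + 3"]
    by (auto simp: u_def mult_ac power_add eval_nat_numeral)
  have IH: "(1 + x) * (1 + x * r * u) * B = A * u * (1 + x * u) * (1 + x * r)"
    using Suc.IH by (simp add: A_def B_def u_def)
  have B: "fine_term (x * r\<^sup>2) r (Suc k) =
      B * (- (x * r\<^sup>2) * (1 + x * (r\<^sup>2 * u)) / (1 + x * r * (r\<^sup>2 * u)))"
    by (simp add: fine_term_Suc B_def u_def mult_ac)
  have A: "fine_term x r (Suc k) = A * (- x * (1 + x * u) / (1 + x * r * u))"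
    by (simp add: fine_term_Suc A_def u_def)
  have "(1 + x) * (1 + x * r * (r\<^sup>2 * u)) * fine_term (x * r\<^sup>2) r (Suc k) =
      ((1 + x) * (1 + x * r * u) * B) / (1 + x * r * u) * (- (x * r\<^sup>2) * (1 + x * (r\<^sup>2 * u)))"
    unfolding B using n1 n2 by simp
  also have "\<dots> = fine_term x r (Suc k) * (r\<^sup>2 * u) * (1 + x * (r\<^sup>2 * u)) * (1 + x * r)"
    unfolding IH A by simp
  finally show ?case by (simp only: u)
qed

text \<open>By the shift relation and the term ratio, all four terms are multiples of
  \<open>fine_term x r k\<close> by rational functions of x, r and \<open>u = r ^ (2 * k)\<close>;
  clearing denominators leaves a polynomial identity.\<close>

lemma fine_term_telescope:
  assumes "norm x < 1" "norm r < 1"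
  shows "fine_term x r k - x\<^sup>2 * r * fine_term (x * r\<^sup>2) r k =
    fine_term x r k * (1 - x\<^sup>2 * r ^ (2 * k)) / (1 + x) -
    fine_term x r (Suc k) * (1 - x\<^sup>2 * r ^ (2 * Suc k)) / (1 + x)"
proof -
  define u where "u = r ^ (2 * k)"
  define A where "A = fine_term x r k"
  define B where "B = fine_term (x * r\<^sup>2) r k"
  have u: "r ^ (2 * Suc k) = r\<^sup>2 * u" by (simp add: u_def power2_eq_square)
  have n1: "1 + x * r * u \<noteq> 0"
    using one_plus_nonzero[of "x * r ^ Suc (2 * k)"]
      norm_mult_power_less_one[OF assms, of "Suc (2 * k)"] by (auto simp: u_def mult_ac)
  have n0: "1 + x \<noteq> 0" using one_plus_nonzero assms by simp
  have "(1 + x) * (1 + x * r * u) * B = A * u * (1 + x * u) * (1 + x * r)"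
    using fine_term_shift[OF assms, of k] by (simp add: A_def B_def u_def)
  then have B: "B = A * u * (1 + x * u) * (1 + x * r) / ((1 + x) * (1 + x * r * u))"
    using n0 n1 by (simp add: nonzero_eq_divide_eq mult_ac)
  have A: "fine_term x r (Suc k) = A * (- x * (1 + x * u) / (1 + x * r * u))"
    by (simp add: fine_term_Suc A_def u_def)
  \<comment> \<open>The denominators are cleared over atomic variables, so that the concrete
    expressions only have to satisfy the polynomial hypothesis.\<close>
  have clear: "A - a * (A * b / (d * e)) = A * c / d - A * (f / e) * g / d"
    if "d * e - a * b = c * e - f * g" "d \<noteq> 0" "e \<noteq> 0" for a b c d e f g :: complex
  proof -
    have "A - a * (A * b / (d * e)) = A * (d * e - a * b) / (d * e)"
      using that(2,3) by (simp add: field_simps)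
    also have "\<dots> = A * c / d - A * (f / e) * g / d"
      unfolding that(1) using that(2,3) by (simp add: field_simps)
    finally show ?thesis .
  qed
  have "(1 + x) * (1 + x * r * u) - x\<^sup>2 * r * (u * (1 + x * u) * (1 + x * r)) =
      (1 - x\<^sup>2 * u) * (1 + x * r * u) - (- x * (1 + x * u)) * (1 - x\<^sup>2 * (r\<^sup>2 * u))"
    by (simp add: algebra_simps power2_eq_square)
  from clear[OF this n0 n1]
  have "A - x\<^sup>2 * r * B = A * (1 - x\<^sup>2 * u) / (1 + x) -
      fine_term x r (Suc k) * (1 - x\<^sup>2 * (r\<^sup>2 * u)) / (1 + x)"
    unfolding A B by (simp only: mult.assoc)
  then show ?thesis by (simp only: u) (simp add: A_def B_def u_def)
qed

text \<open>Summing the telescoping relation leaves only the boundary term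
  \<open>C 0 = (1 - x\<^sup>2) / (1 + x) = 1 - x\<close>, since \<open>C\<close> tends to 0 along
  with the terms of a convergent series.\<close>

lemma suminf_fine_term_shift:
  assumes "norm x < 1" "norm r < 1"
  shows "suminf (fine_term x r) = 1 - x + x\<^sup>2 * r * suminf (fine_term (x * r\<^sup>2) r)"
proof -
  define C where "C k = fine_term x r k * (1 - x\<^sup>2 * r ^ (2 * k)) / (1 + x)" for k
  have n0: "1 + x \<noteq> 0" using one_plus_nonzero assms by simp
  have "norm (r\<^sup>2) < 1"
    using assms by (simp add: norm_power power_less_one_iff)
  then have "(\<lambda>k. fine_term x r k * (1 - x\<^sup>2 * (r\<^sup>2) ^ k) / (1 + x)) \<longlonglongrightarrow>
      0 * (1 - x\<^sup>2 * 0) / (1 + x)"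
    using summable_LIMSEQ_zero[OF summable_fine_term[OF assms]] n0
    by (intro tendsto_intros)
  then have "C \<longlonglongrightarrow> 0" by (simp add: C_def [abs_def] power_mult)
  then have "(\<lambda>k. C k - C (Suc k)) sums (C 0 - 0)" by (rule telescope_sums')
  moreover have "C 0 = 1 - x"
    using n0 by (simp add: C_def fine_term_def field_simps power2_eq_square)
  moreover have "fine_term x r k - x\<^sup>2 * r * fine_term (x * r\<^sup>2) r k = C k - C (Suc k)" for k
    using fine_term_telescope[OF assms] by (simp add: C_def)
  ultimately have 1: "(\<lambda>k. fine_term x r k - x\<^sup>2 * r * fine_term (x * r\<^sup>2) r k) sums (1 - x)"
    by simp
  have "norm (x * r\<^sup>2) < 1" using norm_mult_power_less_one[OF assms] .
  then have "(\<lambda>k. fine_term x r k - x\<^sup>2 * r * fine_term (x * r\<^sup>2) r k) sums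
      (suminf (fine_term x r) - x\<^sup>2 * r * suminf (fine_term (x * r\<^sup>2) r))"
    using assms by (intro sums_diff sums_mult summable_sums summable_fine_term)
  from sums_unique2[OF this 1] show ?thesis by (simp add: algebra_simps)
qed

section \<open>Iteration and the partial theta series\<close>

lemma suminf_fine_term_iterate:
  assumes "norm x < 1" "norm r < 1"
  shows "suminf (fine_term x r) =
    (\<Sum>j<2 * n. (- x) ^ j * r ^ (j choose 2)) +
    x ^ (2 * n) * r ^ (2 * n choose 2) * suminf (fine_term (x * r ^ (2 * n)) r)"
proof (induction n)
  case 0
  show ?case by (simp add: binomial_eq_0)
next
  case (Suc n)
  define y where "y = x * r ^ (2 * n)"
  define w where "w = x ^ (2 * n) * r ^ (2 * n choose 2)"
  have ch: "Suc j choose 2 = (j choose 2) + j" for j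
    by (simp add: numeral_2_eq_2)
  have y: "norm y < 1" using norm_mult_power_less_one[OF assms] by (simp add: y_def)
  \<comment> \<open>One more use of the functional equation, at y, turns \<open>w * S(y)\<close>
    into \<open>w - w * y + w * y\<^sup>2 * r * S(y * r\<^sup>2)\<close>: w and
    \<open>- w * y\<close> are the theta terms of index \<open>2 * n\<close> and
    \<open>2 * n + 1\<close>, and the last coefficient is the next prefactor.\<close>
  have w1: "x ^ Suc (2 * n) * r ^ (Suc (2 * n) choose 2) = w * y"
    by (simp add: ch w_def y_def power_add)
  have w2: "x ^ (2 * Suc n) * r ^ (2 * Suc n choose 2) = w * y\<^sup>2 * r"
    by (simp add: ch w_def y_def power2_eq_square power_add[symmetric] add.commute)
  have y2: "y * r\<^sup>2 = x * r ^ (2 * Suc n)"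
    by (simp add: y_def power2_eq_square)
  have "(\<Sum>j<2 * Suc n. (- x) ^ j * r ^ (j choose 2)) =
      (\<Sum>j<2 * n. (- x) ^ j * r ^ (j choose 2)) + w - x ^ Suc (2 * n) * r ^ (Suc (2 * n) choose 2)"
    by (simp add: w_def)
  moreover have "suminf (fine_term x r) =
      (\<Sum>j<2 * n. (- x) ^ j * r ^ (j choose 2)) + w * suminf (fine_term y r)"
    using Suc.IH by (simp only: w_def y_def)
  ultimately show ?case
    unfolding w1 w2 y2[symmetric]
    by (simp only: suminf_fine_term_shift[OF y assms(2)]) (simp add: algebra_simps)
qed

lemma summable_partial_theta:
  fixes x r :: complex
  assumes "norm x < 1" "norm r < 1"
  shows "summable (\<lambda>j. (- x) ^ j * r ^ (j choose 2))"
proof (rule summable_comparison_test'[OF summable_geometric[of "norm x"]])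
  fix n
  show "norm ((- x) ^ n * r ^ (n choose 2)) \<le> norm x ^ n"
    using assms by (simp add: norm_mult norm_power mult_left_le power_le_one)
qed (use assms in auto)

lemma suminf_fine_term:
  assumes "norm x < 1" "norm r < 1"
  shows "suminf (fine_term x r) = (\<Sum>j. (- x) ^ j * r ^ (j choose 2))"
proof -
  \<comment> \<open>Since \<open>x * r ^ (2 * n)\<close> never leaves the disc of radius
    \<open>norm x\<close>, one constant bounds \<open>S\<close> at all iterates, and the prefactor
    of the remainder decays geometrically.\<close>
  define M where "M = suminf (fine_majorant (norm x) (norm r))"
  define R where
    "R n = x ^ (2 * n) * r ^ (2 * n choose 2) * suminf (fine_term (x * r ^ (2 * n)) r)" for n
  have R: "norm (R n) \<le> ((norm x)\<^sup>2) ^ n * M" for n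
  proof -
    have "norm (suminf (fine_term (x * r ^ (2 * n)) r)) \<le> M"
      unfolding M_def using assms
      by (intro norm_suminf_fine_term_le)
         (auto simp: norm_mult norm_power intro!: mult_left_le power_le_one)
    moreover have "norm (x ^ (2 * n) * r ^ (2 * n choose 2)) \<le> ((norm x)\<^sup>2) ^ n"
      using assms by (simp add: norm_mult norm_power power_mult mult_left_le power_le_one)
    ultimately show ?thesis
      unfolding R_def norm_mult[of _ "suminf _"] by (intro mult_mono) auto
  qed
  have "(\<lambda>n. ((norm x)\<^sup>2) ^ n * M) \<longlonglongrightarrow> 0 * M"
    using assms by (intro tendsto_intros LIMSEQ_power_zero) (simp add: power_less_one_iff)
  then have "(\<lambda>n. ((norm x)\<^sup>2) ^ n * M) \<longlonglongrightarrow> 0" by simp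
  then have "R \<longlonglongrightarrow> 0"
    by (rule tendsto_0_le[where K = 1])
       (use order_trans[OF R abs_ge_self] in simp)
  then have "(\<lambda>n. suminf (fine_term x r) - R n) \<longlonglongrightarrow> suminf (fine_term x r) - 0"
    by (intro tendsto_intros)
  moreover have "suminf (fine_term x r) - R n = (\<Sum>j<2 * n. (- x) ^ j * r ^ (j choose 2))" for n
    using suminf_fine_term_iterate[OF assms, of n] by (simp add: R_def)
  ultimately have "(\<lambda>n. \<Sum>j<2 * n. (- x) ^ j * r ^ (j choose 2)) \<longlonglongrightarrow> suminf (fine_term x r)"
    by simp
  \<comment> \<open>The iteration yields only partial sums of even length; as the theta series is
    summable, this subsequence has the full sum as its limit.\<close>
  moreover have "(\<lambda>n. \<Sum>j<2 * n. (- x) ^ j * r ^ (j choose 2)) \<longlonglongrightarrow>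
      (\<Sum>j. (- x) ^ j * r ^ (j choose 2))"
    using LIMSEQ_subseq_LIMSEQ[OF summable_LIMSEQ[OF summable_partial_theta[OF assms]],
        of "\<lambda>n. 2 * n"]
    by (simp add: o_def strict_mono_def)
  ultimately show ?thesis by (rule LIMSEQ_unique)
qed

section \<open>Matching the three series with \<open>S(q)\<close>\<close>

text \<open>Splitting off n leaves \<open>(\<rho> - 2) * n * (n - 1) / 2\<close>, which is the
  exponent of the partial theta series at \<open>x = q\<close>,
  \<open>r = q ^ (\<rho> - 2)\<close>.\<close>

lemma theta_exp_eq:
  assumes "\<rho> \<ge> 2"
  shows "theta_exp \<rho> n = int (n + (\<rho> - 2) * (n choose 2))"
proof -
  have "int n * (int n - 1) = 2 * int (n choose 2)"
  proof (induction n)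
    case (Suc n)
    have "Suc n choose 2 = (n choose 2) + n" by (simp add: numeral_2_eq_2)
    with Suc show ?case by (simp add: algebra_simps)
  qed simp
  then have "int n * ((int \<rho> - 2) * int n - (int \<rho> - 4)) =
      2 * (int n + (int \<rho> - 2) * int (n choose 2))"
    by (simp add: algebra_simps)
  then show ?thesis
    using assms by (simp add: theta_exp_def of_nat_diff)
qed

text \<open>With a a power of q, \<open>(1 + 1 / a) / (1 + 1 / (a * q ^ m))\<close> equals
  \<open>q ^ m * (1 + a) / (1 + a * q ^ m)\<close>. The extra \<open>q ^ m\<close> times
  \<open>p ^ (m - 1)\<close> is q, so both sides have the same term ratio. Convergence of the series
  in p is thus inherited, although p lies outside the unit disc.\<close>

lemma fine_term_inverse:
  fixes q p :: complex
  assumes "0 < norm q" "norm q < 1" "p = inverse q" "m \<ge> 1"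
  shows "(- 1) ^ n * p ^ ((m - 1) * n) *
    (qpoch (- p) (p ^ (2 * m)) n / qpoch (- (p ^ (m + 1))) (p ^ (2 * m)) n) =
    fine_term q (q ^ m) n"
proof (induction n)
  case 0
  show ?case by (simp add: fine_term_def)
next
  case (Suc n)
  have q: "q \<noteq> 0" using assms by auto
  have p: "p ^ k = 1 / q ^ k" for k
    using assms by (simp add: power_inverse inverse_eq_divide power_one_over)
  have nz: "1 + q ^ Suc k \<noteq> 0" for k
    using norm_mult_power_less_one[OF assms(2,2), of k] by (intro one_plus_nonzero) auto
  \<comment> \<open>\<open>1 + a\<close> and \<open>1 + a * q ^ m\<close> are the factors that the
    numerator and the denominator of the q-series gain in passing from n to
    \<open>n + 1\<close>.\<close>
  define a where "a = q ^ (1 + 2 * m * n)"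
  have a: "a \<noteq> 0" using q by (simp add: a_def)
  have n1: "1 + a * q ^ m \<noteq> 0"
    using nz[of "2 * m * n + m"] by (simp add: a_def power_add mult.assoc)
  have e1: "p * (p ^ (2 * m)) ^ n = 1 / a"
    using assms(3) by (simp add: a_def p inverse_eq_divide power_mult power_one_over)
  have e2: "p ^ (m + 1) * (p ^ (2 * m)) ^ n = 1 / (a * q ^ m)"
    using e1 by (simp add: p power_add assms(3) field_simps)
  have e3: "p ^ ((m - 1) * Suc n) = p ^ ((m - 1) * n) * p ^ (m - 1)"
    by (simp add: power_add)
  have e4: "p ^ (m - 1) = q / q ^ m"
    using assms(4) q by (cases m) (auto simp: p)
  have "fine_term q (q ^ m) (Suc n) =
      fine_term q (q ^ m) n * (- q * (1 + a) / (1 + a * q ^ m))"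
    by (simp add: fine_term_Suc a_def power_mult[symmetric] mult_ac)
  also have "- q * (1 + a) / (1 + a * q ^ m) =
      - (p ^ (m - 1) * ((1 + 1 / a) / (1 + 1 / (a * q ^ m))))"
  proof -
    have "1 + 1 / a = (1 + a) / a" "1 + 1 / (a * q ^ m) = (1 + a * q ^ m) / (a * q ^ m)"
      using a q by (simp_all add: field_simps)
    then show ?thesis unfolding e4 using a q by simp
  qed
  finally have step: "fine_term q (q ^ m) (Suc n) = fine_term q (q ^ m) n *
      - (p ^ (m - 1) * ((1 + 1 / a) / (1 + 1 / (a * q ^ m))))" .
  have num: "qpoch (- p) (p ^ (2 * m)) (Suc n) = qpoch (- p) (p ^ (2 * m)) n * (1 + 1 / a)"
    using e1 by simp
  have den: "qpoch (- (p ^ (m + 1))) (p ^ (2 * m)) (Suc n) =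
      qpoch (- (p ^ (m + 1))) (p ^ (2 * m)) n * (1 + 1 / (a * q ^ m))"
    using e2 by simp
  show ?case
    unfolding step num den e3 Suc.IH[symmetric] by simp
qed

theorem theorem1:
  fixes \<rho> :: nat and q p :: complex
  assumes "\<rho> \<ge> 3" and "0 < norm q" and "norm q < 1" and "p = inverse q"
  shows
    "(summable (\<lambda>n. (-1) ^ n * q powi theta_exp \<rho> n) \<and>
      summable (\<lambda>n. (-1) ^ Suc n * q ^ Suc n *
        ((\<Prod>k<Suc n. 1 + q ^ (1 + (2 * \<rho> - 4) * k)) /
         (\<Prod>k<Suc n. 1 + q ^ (\<rho> - 1 + (2 * \<rho> - 4) * k)))) \<and>
      summable (\<lambda>n. (-1) ^ Suc n * p ^ ((\<rho> - 3) * Suc n) *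
        ((\<Prod>k<Suc n. 1 + p ^ (1 + (2 * \<rho> - 4) * k)) /
         (\<Prod>k<Suc n. 1 + p ^ (\<rho> - 1 + (2 * \<rho> - 4) * k)))) \<and>
      (\<Sum>n. (-1) ^ n * q powi theta_exp \<rho> n) =
        1 + (\<Sum>n. (-1) ^ Suc n * q ^ Suc n *
          ((\<Prod>k<Suc n. 1 + q ^ (1 + (2 * \<rho> - 4) * k)) /
           (\<Prod>k<Suc n. 1 + q ^ (\<rho> - 1 + (2 * \<rho> - 4) * k)))) \<and>
      (\<Sum>n. (-1) ^ n * q powi theta_exp \<rho> n) =
        1 + (\<Sum>n. (-1) ^ Suc n * p ^ ((\<rho> - 3) * Suc n) *
          ((\<Prod>k<Suc n. 1 + p ^ (1 + (2 * \<rho> - 4) * k)) /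
           (\<Prod>k<Suc n. 1 + p ^ (\<rho> - 1 + (2 * \<rho> - 4) * k))))) \<and>
     (summable (\<lambda>n. (-1) ^ n * q ^ n *
        (qpoch (- q) (q ^ (2 * \<rho> - 4)) n / qpoch (- (q ^ (\<rho> - 1))) (q ^ (2 * \<rho> - 4)) n)) \<and>
      summable (\<lambda>n. (-1) ^ n * p ^ ((\<rho> - 3) * n) *
        (qpoch (- p) (p ^ (2 * \<rho> - 4)) n / qpoch (- (p ^ (\<rho> - 1))) (p ^ (2 * \<rho> - 4)) n)) \<and>
      (\<Sum>n. (-1) ^ n * q powi theta_exp \<rho> n) =
        (\<Sum>n. (-1) ^ n * q ^ n *
          (qpoch (- q) (q ^ (2 * \<rho> - 4)) n / qpoch (- (q ^ (\<rho> - 1))) (q ^ (2 * \<rho> - 4)) n)) \<and>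
      (\<Sum>n. (-1) ^ n * q powi theta_exp \<rho> n) =
        (\<Sum>n. (-1) ^ n * p ^ ((\<rho> - 3) * n) *
          (qpoch (- p) (p ^ (2 * \<rho> - 4)) n / qpoch (- (p ^ (\<rho> - 1))) (p ^ (2 * \<rho> - 4)) n)))"
proof -
  \<comment> \<open>For \<open>\<rho> \<ge> 3\<close> every natural subtraction in the statement is
    exact, and m is at least 1, so \<open>m - 1\<close> is exact too.\<close>
  define m where "m = \<rho> - 2"
  have m: "m \<ge> 1" "2 * \<rho> - 4 = 2 * m" "\<rho> - 1 = m + 1" "\<rho> - 3 = m - 1"
    using assms(1) by (auto simp: m_def)
  define r where "r = q ^ m"
  have r: "norm r < 1"
    using assms m(1) by (simp add: r_def norm_power power_less_one_iff)
  have th: "(-1) ^ n * q powi theta_exp \<rho> n = (- q) ^ n * r ^ (n choose 2)" for n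
  proof -
    have "q powi theta_exp \<rho> n = q ^ (n + m * (n choose 2))"
      using assms(1) by (simp only: theta_exp_eq m_def power_int_of_nat)
    then show ?thesis
      by (simp add: r_def power_add power_mult power_minus[of q])
  qed
  have second: "(-1) ^ n * q ^ n * (qpoch (- q) (q ^ (2 * m)) n / qpoch (- (q ^ (m + 1))) (q ^ (2 * m)) n)
      = fine_term q r n" for n
    by (simp add: fine_term_def r_def power_minus[of q] power_mult[symmetric] mult.commute)
  have third: "(-1) ^ n * p ^ ((m - 1) * n) *
      (qpoch (- p) (p ^ (2 * m)) n / qpoch (- (p ^ (m + 1))) (p ^ (2 * m)) n) = fine_term q r n" for n
    using fine_term_inverse[OF assms(2-4) m(1)] by (simp add: r_def)
  have prods: "(\<Prod>k<n. 1 + z ^ (1 + 2 * m * k)) = qpoch (- z) (z ^ (2 * m)) n"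
    "(\<Prod>k<n. 1 + z ^ (m + 1 + 2 * m * k)) = qpoch (- (z ^ (m + 1))) (z ^ (2 * m)) n" for z n
    by (simp_all add: qpoch_uminus_prod power_add power_mult mult.assoc)
  have S: "summable (fine_term q r)"
    using assms r by (intro summable_fine_term)
  have S1: "summable (\<lambda>n. fine_term q r (Suc n))"
    using S by (subst summable_Suc_iff)
  have T: "(\<Sum>n. (- q) ^ n * r ^ (n choose 2)) = suminf (fine_term q r)"
    using suminf_fine_term[OF assms(3) r] by (rule sym)
  \<comment> \<open>The product forms are indexed by \<open>Suc n\<close>, so the term at index 0,
    equal to 1, is split off.\<close>
  have T1: "suminf (fine_term q r) = 1 + (\<Sum>n. fine_term q r (Suc n))"
    using suminf_split_head[OF S] by (simp add: fine_term_def)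
  show ?thesis
    unfolding m(2-4) prods th second third T
    by (intro conjI S S1 T1 refl summable_partial_theta assms(3) r)
qed

end
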